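(* Let $K\subset\mathbb{R}^n$ be a star body and let $0<p\leqslant n$. Then, for all $\lambda\in(0,1)$ and any $r>0$, $$\frac{\mathrm{vol}\bigl((1-\lambda)\cdot K\,\widetilde{+}_p\,\lambda\cdot rB_n\bigr)}{\widetilde{\mathrm{S}}_p\bigl((1-\lambda)\cdot K\,\widetilde{+}_p\,\lambda\cdot rB_n\bigr)}\leqslant(1-\lambda)\,\frac{\mathrm{vol}(K)}{\widetilde{\mathrm{S}}_p(K)}+\lambda\,\frac{\mathrm{vol}(rB_n)}{\widetilde{\mathrm{S}}_p(rB_n)}.$$ Equality for $p\neq n$, for some $\lambda\in(0,1)$, holds if and only if $K$ is a Euclidean ball centred at the origin.
   Context: A star body is a nonempty compact set $K\subset\mathbb{R}^n$ with $[0,x]\subset K$ for all $x\in K$, whose radial function $\rho_K(u)=\sup\{\lambda\geqslant0:\lambda u\in K\}$, $u\in\mathbb{S}^{n-1}$, is positive and continuous. $B_n$ is the closed Euclidean unit ball and $\mathrm{vol}$ is Lebesgue measure. For $p\neq0$ and star bodies $K,E$, the $p$-radial sum $K\,\widetilde{+}_p\,E$ is the star body with $\rho_{K\widetilde{+}_pE}(u)^p=\rho_K(u)^p+\rho_E(u)^p$. The $p$-scalar multiplication is $\lambda\cdot K=\lambda^{1/p}K$ (so $\lambda\cdot rB_n=\lambda^{1/p}rB_n$). The $L_p$ dual surface area of a star body $K$ is $$\widetilde{\mathrm{S}}_p(K)=\left.\frac{d^+}{d\varepsilon}\right|_{\varepsilon=0}\mathrm{vol}\bigl(K\,\widetilde{+}_p\,\varepsilon\cdot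 B_n\bigr)=\frac1p\int_{\mathbb{S}^{n-1}}\rho_K(u)^{n-p}\,du,$$ with $du$ the spherical Lebesgue measure. *)

theory Defs
  imports "HOL-Analysis.Analysis"
begin

definition radial :: "'a::euclidean_space set \<Rightarrow> 'a \<Rightarrow> real" where
  "radial K u = Sup {t. 0 \<le> t \<and> t *\<^sub>R u \<in> K}"

definition star_body :: "'a::euclidean_space set \<Rightarrow> bool" where
  "star_body K \<longleftrightarrow>
     K \<noteq> {} \<and> compact K \<and> (\<forall>x\<in>K. closed_segment 0 x \<subseteq> K) \<and>
     (\<forall>u\<in>sphere 0 1. 0 < radial K u) \<and> continuous_on (sphere 0 1) (radial K)"

text \<open>
  The description is meaningful for star bodies \<open>K\<close>, \<open>E\<close> and \<open>p \<noteq> 0\<close>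
  (\<open>ex1_radial_sum\<close> below). Since \<open>0 powr p = 0\<close>, it also gives \<open>K\<close> when \<open>E = {0}\<close>
  (\<open>radial_sum_zero\<close>), which is the value needed at \<open>\<epsilon> = 0\<close> in
  \<open>dual_surface_area\<close>.
\<close>

definition radial_sum :: "real \<Rightarrow> 'a::euclidean_space set \<Rightarrow> 'a set \<Rightarrow> 'a set" where
  "radial_sum p K E =
     (THE M. star_body M \<and>
        (\<forall>u\<in>sphere 0 1. radial M u powr p = radial K u powr p + radial E u powr p))"

definition radial_scale :: "real \<Rightarrow> real \<Rightarrow> 'a::euclidean_space set \<Rightarrow> 'a set" where
  "radial_scale p c K = (\<lambda>x. (c powr (1 / p)) *\<^sub>R x) ` K"

definition dual_surface_area :: "real \<Rightarrow> 'a::euclidean_space set \<Rightarrow> real" where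
  "dual_surface_area p K =
     vector_derivative
       (\<lambda>\<epsilon>. measure lebesgue (radial_sum p K (radial_scale p \<epsilon> (cball 0 1)))) (at_right 0)"

lemma star_body_mem_iff:
  fixes K :: "'a::euclidean_space set"
  assumes K: "star_body K" and u: "u \<in> sphere 0 1" and t: "0 \<le> t"
  shows "t *\<^sub>R u \<in> K \<longleftrightarrow> t \<le> radial K u"
proof -
  let ?A = "{t. 0 \<le> t \<and> t *\<^sub>R u \<in> K}"
  have cK: "compact K" and seg: "\<And>x. x \<in> K \<Longrightarrow> closed_segment 0 x \<subseteq> K" and "K \<noteq> {}"
    using K by (auto simp: star_body_def)
  then have "0 \<in> K" by (metis ends_in_segment(1) ex_in_conv subsetD)
  then have ne: "?A \<noteq> {}" by (auto intro: exI[of _ 0])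
  obtain B where B: "\<And>x. x \<in> K \<Longrightarrow> norm x \<le> B"
    using compact_imp_bounded[OF cK] by (auto simp: bounded_iff)
  have bdd: "bdd_above ?A"
    using B u by (intro bdd_aboveI[of _ B]) fastforce
  have "closed ((\<lambda>t. t *\<^sub>R u) -` K)"
    by (intro continuous_closed_vimage compact_imp_closed[OF cK] continuous_intros)
  moreover have "?A = {0..} \<inter> ((\<lambda>t. t *\<^sub>R u) -` K)" by auto
  ultimately have "closed ?A" by auto
  then have S: "radial K u \<in> ?A"
    unfolding radial_def using closed_contains_Sup[OF ne bdd] by blast
  show ?thesis
  proof
    assume "t *\<^sub>R u \<in> K"
    then show "t \<le> radial K u"
      unfolding radial_def using t by (intro cSup_upper bdd) auto
  next
    assume le: "t \<le> radial K u"
    show "t *\<^sub>R u \<in> K"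
    proof (cases "radial K u = 0")
      case True then show ?thesis using S le t by auto
    next
      case False
      then have "t *\<^sub>R u = (t / radial K u) *\<^sub>R (radial K u *\<^sub>R u)" by simp
      moreover have "0 \<le> t / radial K u" "t / radial K u \<le> 1"
        using S le t False by (auto simp: divide_simps)
      ultimately have "t *\<^sub>R u \<in> closed_segment 0 (radial K u *\<^sub>R u)"
        unfolding in_segment by (intro exI[of _ "t / radial K u"]) auto
      then show ?thesis using seg S by blast
    qed
  qed
qed

lemma star_body_eqI:
  fixes K :: "'a::euclidean_space set"
  assumes K: "star_body K" and L: "star_body L"
    and eq: "\<And>u. u \<in> sphere 0 1 \<Longrightarrow> radial K u = radial L u"
  shows "K = L"
proof -
  obtain b :: 'a where b: "b \<in> sphere 0 1" using norm_Basis nonempty_Basis by fastforce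
  have "x \<in> K \<longleftrightarrow> x \<in> L" for x
  proof -
    obtain u where u: "u \<in> sphere 0 1" "x = norm x *\<^sub>R u"
    proof (cases "x = 0")
      case True then show ?thesis using that[of b] b by simp
    next
      case False then show ?thesis using that[of "x /\<^sub>R norm x"] by simp
    qed
    show ?thesis
      using star_body_mem_iff[OF K u(1), of "norm x"] star_body_mem_iff[OF L u(1), of "norm x"]
        eq[OF u(1)] u(2) by simp
  qed
  then show ?thesis by blast
qed

lemma ex_star_body_radial:
  fixes g :: "'a::euclidean_space \<Rightarrow> real"
  assumes cont: "continuous_on (sphere 0 1) g" and pos: "\<And>u. u \<in> sphere 0 1 \<Longrightarrow> 0 < g u"
  shows "\<exists>M. star_body M \<and> (\<forall>u\<in>sphere 0 1. radial M u = g u)"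
proof -
  let ?h = "\<lambda>z. (fst z * g (snd z)) *\<^sub>R snd z"
  define M where "M = ?h ` ({0..1} \<times> sphere 0 1)"
  obtain b :: 'a where b: "b \<in> sphere 0 1" using norm_Basis nonempty_Basis by fastforce
  have ne: "M \<noteq> {}" unfolding M_def using b by auto
  have "continuous_on ({0..1} \<times> sphere 0 1) (\<lambda>z. g (snd z))"
    by (rule continuous_on_compose2[OF cont]) (auto intro!: continuous_intros)
  then have cM: "compact M" unfolding M_def
    by (intro compact_continuous_image compact_Times continuous_intros) auto
  have seg: "closed_segment 0 x \<subseteq> M" if x: "x \<in> M" for x
  proof
    fix y assume "y \<in> closed_segment 0 x"
    then obtain s where s: "0 \<le> s" "s \<le> 1" "y = s *\<^sub>R x" by (auto simp: in_segment)
    obtain t u where tu: "0 \<le> t" "t \<le> 1" "u \<in> sphere 0 1" "x = (t * g u) *\<^sub>R u"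
      using x unfolding M_def by auto
    have "y = ?h (s * t, u)" using s tu by (simp add: mult.assoc)
    moreover have "(s * t, u) \<in> {0..1} \<times> sphere 0 1" using s tu by (auto intro: mult_le_one)
    ultimately show "y \<in> M" unfolding M_def by blast
  qed
  have rad: "radial M u = g u" if u: "u \<in> sphere 0 1" for u
  proof -
    have "{t. 0 \<le> t \<and> t *\<^sub>R u \<in> M} = {0..g u}"
    proof (intro equalityI subsetI)
      fix t assume "t \<in> {t. 0 \<le> t \<and> t *\<^sub>R u \<in> M}"
      then obtain s v where s: "0 \<le> t" "0 \<le> s" "s \<le> 1" "v \<in> sphere 0 1"
          "t *\<^sub>R u = (s * g v) *\<^sub>R v"
        unfolding M_def by auto
      have "norm (t *\<^sub>R u) = norm ((s * g v) *\<^sub>R v)" by (simp only: s(5))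
      then have t: "t = s * g v" using s(1-4) u pos[OF s(4)] by (simp add: abs_mult)
      show "t \<in> {0..g u}"
      proof (cases "t = 0")
        case True then show ?thesis using pos[OF u] by simp
      next
        case False
        then have "u = v" using s(5) t by simp
        then show ?thesis using t s pos[OF u] by (simp add: mult_left_le_one_le)
      qed
    next
      fix t assume t: "t \<in> {0..g u}"
      have "t *\<^sub>R u = ?h (t / g u, u)" "(t / g u, u) \<in> {0..1} \<times> sphere 0 1"
        using t pos[OF u] u by auto
      then have "t *\<^sub>R u \<in> M" unfolding M_def by (rule image_eqI)
      then show "t \<in> {t. 0 \<le> t \<and> t *\<^sub>R u \<in> M}" using t by auto
    qed
    then show ?thesis unfolding radial_def using pos[OF u] by simp
  qed
  have "continuous_on (sphere 0 1) (radial M)"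
    using cont rad by (metis continuous_on_eq)
  then show ?thesis using ne cM seg rad pos unfolding star_body_def by (intro exI[of _ M]) auto
qed

lemma radial_sum_unique:
  fixes M :: "'a::euclidean_space set"
  assumes "p \<noteq> 0" and M: "star_body M" and N: "star_body N"
    and eq: "\<And>u. u \<in> sphere 0 1 \<Longrightarrow> radial M u powr p = radial N u powr p"
  shows "M = N"
proof (rule star_body_eqI[OF M N])
  fix u :: 'a assume u: "u \<in> sphere 0 1"
  have "0 < radial M u" "0 < radial N u" using M N u by (auto simp: star_body_def)
  moreover have "(radial M u powr p) powr (1 / p) = (radial N u powr p) powr (1 / p)"
    using eq[OF u] by simp
  ultimately show "radial M u = radial N u" using \<open>p \<noteq> 0\<close> by (simp add: powr_powr)
qed

lemma ex1_radial_sum: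
  fixes K E :: "'a::euclidean_space set"
  assumes p: "p \<noteq> 0" and K: "star_body K" and E: "star_body E"
  shows "\<exists>!M. star_body M \<and>
    (\<forall>u\<in>sphere 0 1. radial M u powr p = radial K u powr p + radial E u powr p)"
proof (rule ex_ex1I)
  let ?g = "\<lambda>u. (radial K u powr p + radial E u powr p) powr (1 / p)"
  have pos: "0 < radial K u" "0 < radial E u" if "u \<in> sphere 0 1" for u
    using K E that by (auto simp: star_body_def)
  have sp: "0 < radial K u powr p + radial E u powr p" if "u \<in> sphere 0 1" for u
    using pos[OF that] by (intro add_pos_pos) auto
  have "continuous_on (sphere 0 1) ?g"
  proof -
    have "continuous_on (sphere 0 1) (radial K)" "continuous_on (sphere 0 1) (radial E)"
      using K E by (auto simp: star_body_def)
    then show ?thesis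
      using pos sp by (intro continuous_on_powr continuous_on_add continuous_on_const ballI; force)
  qed
  then obtain M where M: "star_body M" "\<And>u. u \<in> sphere 0 1 \<Longrightarrow> radial M u = ?g u"
    using ex_star_body_radial[of ?g] sp by fastforce
  have "radial M u powr p = radial K u powr p + radial E u powr p" if "u \<in> sphere 0 1" for u
    using M(2)[OF that] sp[OF that] p by (simp add: powr_powr)
  then show "\<exists>M. star_body M \<and>
      (\<forall>u\<in>sphere 0 1. radial M u powr p = radial K u powr p + radial E u powr p)"
    using M(1) by blast
next
  fix M N :: "'a set"
  assume "star_body M \<and>
      (\<forall>u\<in>sphere 0 1. radial M u powr p = radial K u powr p + radial E u powr p)"
    and "star_body N \<and>
      (\<forall>u\<in>sphere 0 1. radial N u powr p = radial K u powr p + radial E u powr p)"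
  then show "M = N" by (intro radial_sum_unique[OF p]) simp_all
qed

lemma radial_sum_zero:
  fixes K :: "'a::euclidean_space set"
  assumes p: "p \<noteq> 0" and K: "star_body K"
  shows "radial_sum p K {0} = K"
proof -
  have "radial {0::'a} u = 0" if "u \<in> sphere 0 1" for u
  proof -
    have "{t. 0 \<le> t \<and> t *\<^sub>R u \<in> {0::'a}} = {0}" using that by auto
    then show ?thesis by (simp add: radial_def)
  qed
  then have r0: "radial K u powr p + radial {0::'a} u powr p = radial K u powr p"
    if "u \<in> sphere 0 1" for u
    using that by simp
  show ?thesis
    unfolding radial_sum_def
  proof (rule the_equality)
    show "star_body K \<and> (\<forall>u\<in>sphere 0 1.
        radial K u powr p = radial K u powr p + radial {0::'a} u powr p)"
      using K r0 by metis
  next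
    fix M :: "'a set"
    assume M: "star_body M \<and> (\<forall>u\<in>sphere 0 1.
        radial M u powr p = radial K u powr p + radial {0::'a} u powr p)"
    show "M = K"
    proof (rule radial_sum_unique[OF p _ K])
      show "star_body M" using M by blast
      show "radial M u powr p = radial K u powr p" if "u \<in> sphere 0 1" for u
        using M r0[OF that] that by metis
    qed
  qed
qed

end

(*
  With F = rho_K^p and q = n/p >= 1, polar integration over the sphere gives vol(K) / S_p(K) = L(F) / q,
  where L(F) = (INT F^q) / (INT F^(q-1)) is the Lehmer mean. The p-combination replaces F by
  (1 - l) F + l r^p, and L is homogeneous of degree 1, so everything reduces to
  L(F + t) <= L(F) + t for a constant t > 0. This is Chebyshev's correlation inequality for the
  increasing function F and the decreasing function ((F + t) / F)^(q-1) with respect to the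
  weight F^(q-1); for q > 1 equality forces F to be constant.
*)
theory Submission imports Defs begin

text \<open>Two obstacles shape the proof. The dual surface area is given as a one-sided derivative
  of the volume, so its integral formula has to be derived; and the measure on the sphere is
  obtained from Lebesgue measure by pushing the punctured unit ball forward along
  \<open>sgn\<close>, so the polar volume formula is derived from the scaling of Lebesgue measure
  alone. The hypothesis \<open>p <= n\<close> enters as \<open>q >= 1\<close>: it makes
  \<open>a powr (q - 1)\<close> monotone in \<open>a\<close>, which gives both the bounds for the
  difference quotient of the volume and the sign in the correlation inequality. For
  \<open>q = 1\<close> the Lehmer mean is the ordinary mean, which commutes with adding a constant
  for every \<open>F\<close>; this is why equality says nothing when \<open>p = n\<close>. In the
  equality case a vanishing integral yields only an almost-everywhere statement. Continuity of the
  radial function, and the fact that every nonempty open set of directions has positive measure,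
  turn it into a statement about all directions.\<close>

section \<open>Volume in polar coordinates\<close>

text \<open>This is the spherical Lebesgue measure divided by \<open>n\<close>, so that no factor \<open>1 / n\<close>
  appears in the volume formula; the origin is removed because \<open>sgn 0 = 0\<close>.\<close>

definition cone_measure :: "'a::euclidean_space measure" where
  "cone_measure =
     distr (restrict_space lborel (ball 0 1 - {0})) (restrict_space borel (sphere 0 1)) sgn"

lemma space_cone_measure [simp]: "space cone_measure = sphere 0 1"
  by (simp add: cone_measure_def space_restrict_space)

lemma sets_cone_measure [measurable_cong]:
  "sets cone_measure = sets (restrict_space borel (sphere 0 1))"
  by (simp add: cone_measure_def)

lemma measurable_sgn_sphere:
  fixes A :: "'a::euclidean_space set"
  assumes "0 \<notin> A"
  shows "sgn \<in> measurable (restrict_space lborel A) (restrict_space borel (sphere 0 1))"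
proof (rule measurable_restrict_space2)
  show "sgn \<in> space (restrict_space lborel A) \<rightarrow> sphere 0 1"
    using assms by (auto simp: space_restrict_space norm_sgn)
  show "sgn \<in> borel_measurable (restrict_space lborel A)"
    by (intro measurable_restrict_space1) simp
qed

lemma emeasure_cone_measure:
  fixes A :: "'a::euclidean_space set"
  assumes "A \<in> sets cone_measure"
  shows "emeasure cone_measure A = emeasure lborel {x \<in> ball 0 1 - {0}. sgn x \<in> A}"
proof -
  have "emeasure cone_measure A = emeasure (restrict_space lborel (ball 0 1 - {0}))
      (sgn -` A \<inter> (ball 0 1 - {0}))"
    unfolding cone_measure_def using assms
    by (subst emeasure_distr) (auto simp: measurable_sgn_sphere sets_cone_measure space_restrict_space)
  also have "\<dots> = emeasure lborel {x \<in> ball 0 1 - {0}. sgn x \<in> A}"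
    by (subst emeasure_restrict_space) (auto intro!: arg_cong2[of _ _ _ _ emeasure])
  finally show ?thesis .
qed

lemma cone_sets:
  assumes "A \<in> sets cone_measure" and "B \<in> sets borel"
  shows "{x \<in> B - {0}. sgn x \<in> A} \<in> sets borel"
proof -
  have "A \<in> sets borel" using assms by (auto simp: sets_cone_measure sets_restrict_space)
  then have "sgn -` A \<inter> space borel \<in> sets borel" by (intro measurable_sets) auto
  then have "(B - {0}) \<inter> (sgn -` A \<inter> space borel) \<in> sets borel" using assms(2) by auto
  also have "(B - {0}) \<inter> (sgn -` A \<inter> space borel) = {x \<in> B - {0}. sgn x \<in> A}" by auto
  finally show ?thesis .
qed

lemma finite_measure_cone_measure: "finite_measure (cone_measure :: 'a::euclidean_space measure)"
proof
  have "sphere 0 1 \<in> sets (cone_measure :: 'a measure)"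
    by (metis sets.top space_cone_measure)
  then have "emeasure (cone_measure :: 'a measure) (sphere 0 1)
      \<le> emeasure lborel (ball (0::'a) 1)"
    by (subst emeasure_cone_measure) (auto intro!: emeasure_mono)
  then show "emeasure (cone_measure :: 'a measure) (space cone_measure) \<noteq> \<infinity>"
    using emeasure_lborel_ball_finite[of "0::'a" 1] by (auto simp: top_unique)
qed

text \<open>For \<open>v = r > 0\<close> the set is the dilate by \<open>r\<close> of the cone over
  \<open>A\<close> in the unit ball, so Lebesgue measure scales by \<open>r ^ DIM('a)\<close>. For
  \<open>v = 0\<close> both sides vanish, the dimension being positive. The level is an
  \<open>ennreal\<close> because it will be a value of an approximating simple function.\<close>

lemma emeasure_cone_level:
  fixes A :: "'a::euclidean_space set"
  assumes A: "A \<in> sets cone_measure" and v: "v < top"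
  shows "emeasure lborel {x. x \<noteq> 0 \<and> sgn x \<in> A \<and> ennreal (norm x) < v}
    = v ^ DIM('a) * emeasure cone_measure A"
proof (cases v)
  case (real r)
  show ?thesis
  proof (cases "r = 0")
    case True
    then show ?thesis using real by simp
  next
    case False
    then have r: "0 < r" using real by simp
    let ?C = "{x \<in> ball 0 1 - {0}. sgn x \<in> A}"
    let ?D = "{x. x \<noteq> 0 \<and> sgn x \<in> A \<and> ennreal (norm x) < v}"
    have D: "?D = (\<lambda>x. r *\<^sub>R x + 0) ` ?C"
    proof (intro equalityI subsetI)
      fix x assume x: "x \<in> ?D"
      have "x = r *\<^sub>R (x /\<^sub>R r) + 0" "x /\<^sub>R r \<in> ?C"
        using x r real by (auto simp: sgn_scaleR divide_simps ennreal_less_iff)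
      then show "x \<in> (\<lambda>x. r *\<^sub>R x + 0) ` ?C" by (rule image_eqI)
    next
      fix x assume "x \<in> (\<lambda>x. r *\<^sub>R x + 0) ` ?C"
      then show "x \<in> ?D" using r real by (auto simp: sgn_scaleR ennreal_less_iff abs_mult)
    qed
    have C: "?C \<in> sets borel" using cone_sets[OF A] by simp
    have "?D = {x \<in> ball 0 r - {0}. sgn x \<in> A}" using real by (auto simp: ennreal_less_iff)
    then have "?D \<in> sets borel" using cone_sets[OF A] by simp
    then have "emeasure lborel ?D = emeasure lebesgue ?D" by simp
    also have "\<dots> = \<bar>r\<bar> ^ DIM('a) * emeasure lebesgue ?C"
      unfolding D using emeasure_lebesgue_affine[of r 0 ?C] by simp
    also have "\<dots> = v ^ DIM('a) * emeasure cone_measure A"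
      using C r real by (simp add: emeasure_cone_measure[OF A] ennreal_power)
    finally show ?thesis .
  qed
qed (use v in auto)

text \<open>A simple \<open>G\<close> splits the sphere into finitely many level sets, and the
  region below \<open>G\<close> into disjoint truncated cones over them, each of constant
  height.\<close>

lemma emeasure_open_radial_simple:
  fixes G :: "'a::euclidean_space \<Rightarrow> ennreal"
  assumes G: "simple_function cone_measure G" and fin: "\<And>u. u \<in> sphere 0 1 \<Longrightarrow> G u < top"
  shows "{x. x \<noteq> 0 \<and> ennreal (norm x) < G (sgn x)} \<in> sets borel"
    and "emeasure lborel {x. x \<noteq> 0 \<and> ennreal (norm x) < G (sgn x)}
      = (\<integral>\<^sup>+u. G u ^ DIM('a) \<partial>cone_measure)"
proof -
  let ?V = "G ` sphere 0 1"
  let ?A = "\<lambda>v. G -` {v} \<inter> sphere 0 1"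
  let ?D = "\<lambda>v. {x. x \<noteq> 0 \<and> sgn x \<in> ?A v \<and> ennreal (norm x) < v}"
  have fV: "finite ?V" using simple_functionD(1)[OF G] by simp
  have A: "?A v \<in> sets cone_measure" for v using simple_functionD(2)[OF G, of "{v}"] by simp
  have U: "{x. x \<noteq> 0 \<and> ennreal (norm x) < G (sgn x)} = (\<Union>v\<in>?V. ?D v)"
    by (force simp: norm_sgn)
  have D: "?D v \<in> sets borel" for v
  proof -
    have "{x::'a. ennreal (norm x) < v} \<in> sets borel" by measurable
    from cone_sets[OF A[of v] this] show ?thesis by (rule back_subst[of "\<lambda>S. S \<in> sets borel"]) auto
  qed
  show "{x. x \<noteq> 0 \<and> ennreal (norm x) < G (sgn x)} \<in> sets borel"
    unfolding U using fV D by (intro sets.finite_UN) auto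
  have "emeasure lborel (\<Union>v\<in>?V. ?D v) = (\<Sum>v\<in>?V. emeasure lborel (?D v))"
    using fV D by (intro sum_emeasure[symmetric]) (auto simp: disjoint_family_on_def)
  also have "\<dots> = (\<Sum>v\<in>?V. v ^ DIM('a) * emeasure cone_measure (?A v))"
    by (intro sum.cong emeasure_cone_level A) (use fin in auto)
  also have "\<dots> = (\<Sum>v\<in>?V. \<integral>\<^sup>+u. v ^ DIM('a) * indicator (?A v) u \<partial>cone_measure)"
    using A by (simp add: nn_integral_cmult_indicator)
  also have "\<dots> = (\<integral>\<^sup>+u. (\<Sum>v\<in>?V. v ^ DIM('a) * indicator (?A v) u) \<partial>cone_measure)"
    using A by (intro nn_integral_sum[symmetric] borel_measurable_times_ennreal
        borel_measurable_const borel_measurable_indicator)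
  also have "\<dots> = (\<integral>\<^sup>+u. G u ^ DIM('a) \<partial>cone_measure)"
  proof (rule nn_integral_cong)
    fix u :: 'a assume "u \<in> space cone_measure"
    then have u: "u \<in> sphere 0 1" by simp
    have "(\<Sum>v\<in>?V. v ^ DIM('a) * indicator (?A v) u) = (\<Sum>v\<in>?V. if v = G u then v ^ DIM('a) else 0)"
      using u by (intro sum.cong) (auto simp: indicator_def)
    also have "\<dots> = G u ^ DIM('a)" using fV u by simp
    finally show "(\<Sum>v\<in>?V. v ^ DIM('a) * indicator (?A v) u) = G u ^ DIM('a)" .
  qed
  finally show "emeasure lborel {x. x \<noteq> 0 \<and> ennreal (norm x) < G (sgn x)}
      = (\<integral>\<^sup>+u. G u ^ DIM('a) \<partial>cone_measure)" unfolding U .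
qed

lemma tendsto_power_ennreal:
  fixes f :: "'b \<Rightarrow> ennreal"
  assumes "(f \<longlongrightarrow> a) F"
  shows "((\<lambda>x. f x ^ n) \<longlongrightarrow> a ^ n) F"
proof (induction n)
  case (Suc n)
  \<comment> \<open>Multiplication on \<open>ennreal\<close> is discontinuous only at
    \<open>0 * top\<close>, and a power of \<open>a\<close> is never the opposite extreme of
    \<open>a\<close>.\<close>
  have "\<not> ((a = 0 \<and> a ^ n = top) \<or> (a = top \<and> a ^ n = 0))"
    by (cases n) auto
  then show ?case using tendsto_mult_ennreal[OF assms Suc] by simp
qed simp

text \<open>Monotone convergence from below by simple functions. The strict inequality is essential:
  \<open>norm x\<close> lies strictly below a supremum iff it lies strictly below some member, so
  the regions of the approximants exhaust the region of \<open>G\<close>.\<close>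

lemma emeasure_open_radial:
  fixes G :: "'a::euclidean_space \<Rightarrow> ennreal"
  assumes G: "G \<in> borel_measurable cone_measure"
  shows "{x. x \<noteq> 0 \<and> ennreal (norm x) < G (sgn x)} \<in> sets borel"
    and "emeasure lborel {x. x \<noteq> 0 \<and> ennreal (norm x) < G (sgn x)}
      = (\<integral>\<^sup>+u. G u ^ DIM('a) \<partial>cone_measure)"
proof -
  obtain f where f: "\<And>i. simple_function cone_measure (f i)" "incseq f"
      "\<And>i x. f i x < top" "\<And>x. (SUP i. f i x) = G x"
    using borel_measurable_implies_simple_function_sequence'[OF G] by metis
  let ?D = "\<lambda>i. {x. x \<noteq> 0 \<and> ennreal (norm x) < f i (sgn x)}"
  have U: "{x. x \<noteq> 0 \<and> ennreal (norm x) < G (sgn x)} = (\<Union>i. ?D i)"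
    by (auto simp: f(4)[symmetric] less_SUP_iff)
  have D: "?D i \<in> sets borel" for i by (rule emeasure_open_radial_simple(1)[OF f(1,3)])
  show "{x. x \<noteq> 0 \<and> ennreal (norm x) < G (sgn x)} \<in> sets borel"
    unfolding U using D by auto
  have inc: "incseq ?D"
    using f(2) by (auto simp: incseq_def le_fun_def intro: less_le_trans)
  have "emeasure lborel (\<Union>i. ?D i) = (SUP i. emeasure lborel (?D i))"
    using D inc by (intro SUP_emeasure_incseq[symmetric]) auto
  also have "\<dots> = (SUP i. \<integral>\<^sup>+u. f i u ^ DIM('a) \<partial>cone_measure)"
    by (simp add: emeasure_open_radial_simple(2)[OF f(1,3)])
  also have "\<dots> = (\<integral>\<^sup>+u. (SUP i. f i u ^ DIM('a)) \<partial>cone_measure)"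
  proof (rule nn_integral_monotone_convergence_SUP[symmetric])
    show "incseq (\<lambda>i u. f i u ^ DIM('a))"
      using f(2) by (auto simp: incseq_def le_fun_def intro: power_mono)
    show "(\<lambda>u. f i u ^ DIM('a)) \<in> borel_measurable cone_measure" for i
      using borel_measurable_simple_function[OF f(1)] by measurable
  qed
  also have "\<dots> = (\<integral>\<^sup>+u. G u ^ DIM('a) \<partial>cone_measure)"
  proof (rule nn_integral_cong)
    fix u :: 'a
    have "incseq (\<lambda>i. f i u)" using f(2) by (auto simp: incseq_def le_fun_def)
    then have l: "(\<lambda>i. f i u) \<longlonglongrightarrow> G u" using f(4) LIMSEQ_SUP by metis
    have "incseq (\<lambda>i. f i u ^ DIM('a))"
      using f(2) by (auto simp: incseq_def le_fun_def intro: power_mono)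
    then have "(\<lambda>i. f i u ^ DIM('a)) \<longlonglongrightarrow> (SUP i. f i u ^ DIM('a))" by (rule LIMSEQ_SUP)
    moreover have "(\<lambda>i. f i u ^ DIM('a)) \<longlonglongrightarrow> G u ^ DIM('a)"
      by (rule tendsto_power_ennreal[OF l])
    ultimately show "(SUP i. f i u ^ DIM('a)) = G u ^ DIM('a)" by (rule LIMSEQ_unique)
  qed
  finally show "emeasure lborel {x. x \<noteq> 0 \<and> ennreal (norm x) < G (sgn x)}
      = (\<integral>\<^sup>+u. G u ^ DIM('a) \<partial>cone_measure)" unfolding U .
qed

section \<open>Integrals of continuous functions over the sphere\<close>

lemma borel_measurable_cone_measure:
  fixes g :: "'a::euclidean_space \<Rightarrow> real"
  assumes "continuous_on (sphere 0 1) g"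
  shows "g \<in> borel_measurable cone_measure"
  using borel_measurable_continuous_on_restrict[OF assms]
  by (simp add: measurable_cong_sets[OF sets_cone_measure refl])

lemma integrable_cone_measure:
  fixes g :: "'a::euclidean_space \<Rightarrow> real"
  assumes g: "continuous_on (sphere 0 1) g"
  shows "integrable cone_measure g"
proof -
  have "bounded (g ` sphere 0 1)"
    by (intro compact_imp_bounded compact_continuous_image g compact_sphere)
  then obtain B where "\<And>u. u \<in> sphere 0 1 \<Longrightarrow> norm (g u) \<le> B"
    unfolding bounded_iff by blast
  then show ?thesis
    by (intro finite_measure.integrable_const_bound[OF finite_measure_cone_measure, of _ B]
        borel_measurable_cone_measure g) auto
qed

text \<open>The measure has full support: the directions where \<open>g\<close> is nonzero span an
  open cone in the punctured ball, and a nonempty open set is not negligible. This upgrades almost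
  everywhere to everywhere.\<close>

lemma cone_measure_integral_eq_0:
  fixes g :: "'a::euclidean_space \<Rightarrow> real"
  assumes g: "continuous_on (sphere 0 1) g" and nn: "\<And>u. u \<in> sphere 0 1 \<Longrightarrow> 0 \<le> g u"
    and z: "(\<integral>u. g u \<partial>cone_measure) = 0" and u: "u \<in> sphere 0 1"
  shows "g u = 0"
proof (rule ccontr)
  assume ne: "g u \<noteq> 0"
  let ?A = "{u \<in> sphere 0 1. g u \<noteq> 0}"
  have mA: "?A \<in> sets cone_measure"
    using measurable_sets[OF borel_measurable_cone_measure[OF g], of "- {0}"]
    by (simp add: vimage_def Int_def conj_commute)
  have "AE u in cone_measure. g u = 0"
    using z nn by (subst (asm) integral_nonneg_eq_0_iff_AE) (auto intro!: integrable_cone_measure g)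
  then have "emeasure cone_measure ?A = 0"
    using mA by (subst (asm) AE_iff_measurable[of ?A]) auto
  then have null: "emeasure lborel {x \<in> ball 0 1 - {0}. sgn x \<in> ?A} = 0"
    unfolding emeasure_cone_measure[OF mA] .
  have c: "continuous_on (ball 0 1 - {0::'a}) (\<lambda>x. g (sgn x))"
  proof (rule continuous_on_compose2[OF g])
    show "continuous_on (ball 0 1 - {0::'a}) sgn"
      unfolding sgn_div_norm by (intro continuous_intros) auto
  qed (auto simp: norm_sgn split: if_splits)
  let ?S = "(ball 0 1 - {0::'a}) \<inter> (\<lambda>x. g (sgn x)) -` (- {0})"
  have S: "open ?S"
    by (intro continuous_open_preimage c) auto
  have "?S = {x \<in> ball 0 1 - {0}. sgn x \<in> ?A}"
    by (auto simp: norm_sgn)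
  then have "emeasure lborel ?S = 0" using null by simp
  then have "?S \<in> null_sets lebesgue"
    using S by (intro null_sets_completionI null_setsI) auto
  then have "negligible ?S" by (simp only: negligible_iff_null_sets)
  \<comment> \<open>Halving \<open>u\<close> keeps its direction and places the point inside the
    open ball, away from the origin.\<close>
  moreover have "(1/2) *\<^sub>R u \<in> ?S"
    using u ne by (auto simp: sgn_scaleR sgn_div_norm)
  ultimately show False using open_not_negligible[OF S] by blast
qed

lemma cone_measure_integral_pos:
  fixes g :: "'a::euclidean_space \<Rightarrow> real"
  assumes g: "continuous_on (sphere 0 1) g" and pos: "\<And>u. u \<in> sphere 0 1 \<Longrightarrow> 0 < g u"
  shows "0 < (\<integral>u. g u \<partial>cone_measure)"
proof -
  obtain b :: 'a where b: "b \<in> sphere 0 1" using norm_Basis nonempty_Basis by fastforce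
  have "0 \<le> (\<integral>u. g u \<partial>cone_measure)"
    by (intro integral_nonneg_AE) (auto intro!: AE_I2 less_imp_le[OF pos])
  moreover have "(\<integral>u. g u \<partial>cone_measure) \<noteq> 0"
    using cone_measure_integral_eq_0[OF g less_imp_le[OF pos] _ b] pos[OF b] by auto
  ultimately show ?thesis by simp
qed

section \<open>Star bodies and the polar formula for their volume\<close>

lemma star_body_pos: "star_body K \<Longrightarrow> u \<in> sphere 0 1 \<Longrightarrow> 0 < radial K u"
  and star_body_cont: "star_body K \<Longrightarrow> continuous_on (sphere 0 1) (radial K)"
  by (auto simp: star_body_def)

lemma star_body_zero_mem:
  assumes "star_body K"
  shows "0 \<in> K"
proof -
  have "K \<noteq> {}" "\<forall>x\<in>K. closed_segment 0 x \<subseteq> K" using assms by (auto simp: star_body_def)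
  then show ?thesis by (metis ends_in_segment(1) ex_in_conv subsetD)
qed

lemma star_body_mem_sgn:
  assumes K: "star_body K" and "x \<noteq> 0"
  shows "x \<in> K \<longleftrightarrow> norm x \<le> radial K (sgn x)"
  using star_body_mem_iff[OF K, of "sgn x" "norm x"] assms(2) by (simp add: norm_sgn sgn_div_norm)

text \<open>The polar formula is available for strict inequalities, while \<open>K\<close> is
  closed. So \<open>K\<close> is caught between the open region \<open>?O 1\<close> and the dilated
  regions \<open>?O c\<close> with \<open>c > 1\<close>, whose measure is \<open>c ^ DIM('a)\<close>
  times the integral; letting \<open>c\<close> decrease to 1 avoids measuring the boundary.\<close>

lemma star_body_volume:
  fixes K :: "'a::euclidean_space set"
  assumes K: "star_body K"
  shows "measure lebesgue K = (\<integral>u. radial K u ^ DIM('a) \<partial>cone_measure)"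
proof -
  let ?I = "\<integral>u. radial K u ^ DIM('a) \<partial>cone_measure"
  let ?O = "\<lambda>c. {x. x \<noteq> 0 \<and> ennreal (norm x) < ennreal (c * radial K (sgn x))}"
  have int: "integrable cone_measure (\<lambda>u. radial K u ^ DIM('a))"
    by (intro integrable_cone_measure continuous_intros star_body_cont[OF K])
  have cK: "compact K" using K by (simp add: star_body_def)
  then have bK: "K \<in> sets borel" by (simp add: borel_compact)
  note mem = star_body_mem_sgn[OF K]
  have pos: "0 < radial K (sgn x)" if "x \<noteq> 0" for x
    using star_body_pos[OF K, of "sgn x"] that by (simp add: norm_sgn)
  have O: "?O c \<in> sets borel" "emeasure lborel (?O c) = ennreal (c ^ DIM('a) * ?I)" if c: "0 < c" for c
  proof -
    have m: "(\<lambda>u. ennreal (c * radial K u)) \<in> borel_measurable cone_measure"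
      using borel_measurable_cone_measure[OF star_body_cont[OF K]] by measurable
    show "?O c \<in> sets borel" by (rule emeasure_open_radial(1)[OF m])
    have "emeasure lborel (?O c) = (\<integral>\<^sup>+u. ennreal (c * radial K u) ^ DIM('a) \<partial>cone_measure)"
      by (rule emeasure_open_radial(2)[OF m])
    also have "\<dots> = (\<integral>\<^sup>+u. ennreal (c ^ DIM('a) * radial K u ^ DIM('a)) \<partial>cone_measure)"
      using star_body_pos[OF K] c
      by (intro nn_integral_cong) (simp add: ennreal_power power_mult_distrib less_imp_le)
    also have "\<dots> = ennreal (\<integral>u. c ^ DIM('a) * radial K u ^ DIM('a) \<partial>cone_measure)"
      using star_body_pos[OF K] c int
      by (intro nn_integral_eq_integral) (auto intro!: AE_I2 simp: less_imp_le)
    finally show "emeasure lborel (?O c) = ennreal (c ^ DIM('a) * ?I)" by simp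
  qed
  have I0: "0 \<le> ?I"
    using star_body_pos[OF K] by (intro integral_nonneg_AE) (auto intro!: AE_I2 simp: less_imp_le)
  have eK: "emeasure lborel K = ennreal (measure lebesgue K)"
    using emeasure_eq_ennreal_measure[of lborel K] emeasure_bounded_finite[OF compact_imp_bounded[OF cK]] bK
    by (simp add: top.not_eq_extremum)
  have "?O 1 \<subseteq> K" using mem by (auto simp: ennreal_less_iff)
  then have "emeasure lborel (?O 1) \<le> emeasure lborel K" using bK by (intro emeasure_mono) auto
  then have "ennreal ?I \<le> ennreal (measure lebesgue K)" using O(2)[of 1] eK by simp
  then have lower: "?I \<le> measure lebesgue K" by simp
  have upper: "measure lebesgue K \<le> c ^ DIM('a) * ?I" if c: "1 < c" for c
  proof -
    have "x \<in> ?O c" if "x \<in> K" "x \<noteq> 0" for x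
    proof -
      have "norm x \<le> radial K (sgn x)" "radial K (sgn x) < c * radial K (sgn x)"
        using that mem pos c by auto
      then show ?thesis using that by (simp add: ennreal_less_iff)
    qed
    \<comment> \<open>The regions omit the origin, which has no direction; adding this single point
      does not change the measure.\<close>
    then have "K \<subseteq> insert 0 (?O c)" by blast
    then have "emeasure lborel K \<le> emeasure lborel (insert 0 (?O c))"
      using O(1)[of c] c by (intro emeasure_mono) auto
    also have "\<dots> = emeasure lborel (?O c)"
      using O(1)[of c] c by (subst emeasure_insert) auto
    finally have "ennreal (measure lebesgue K) \<le> ennreal (c ^ DIM('a) * ?I)"
      using O(2)[of c] c eK by simp
    then show ?thesis using I0 c by (simp add: ennreal_le_iff)
  qed
  have "((\<lambda>c. c ^ DIM('a) * ?I) \<longlongrightarrow> 1 ^ DIM('a) * ?I) (at_right 1)"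
    by (intro tendsto_intros)
  then have "measure lebesgue K \<le> 1 ^ DIM('a) * ?I"
    by (rule tendsto_lowerbound) (auto intro!: eventually_at_rightI[of 1 2] upper)
  then show ?thesis using lower by simp
qed

section \<open>Translating the Lehmer mean\<close>

definition lehmer_mean :: "real \<Rightarrow> ('a::euclidean_space \<Rightarrow> real) \<Rightarrow> real" where
  "lehmer_mean q F =
     (\<integral>u. F u powr q \<partial>cone_measure) / (\<integral>u. F u powr (q - 1) \<partial>cone_measure)"

lemma continuous_on_powr_pos:
  assumes "continuous_on S F" "\<And>u. u \<in> S \<Longrightarrow> 0 < (F u :: real)"
  shows "continuous_on S (\<lambda>u. F u powr s)"
  by (intro continuous_on_powr assms continuous_intros ballI) (use assms(2) in force)

lemma integral_cone_cong:
  assumes "\<And>u. u \<in> sphere 0 1 \<Longrightarrow> f u = g u"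
  shows "(\<integral>u. f u \<partial>cone_measure) = (\<integral>u. g u \<partial>cone_measure)"
  using assms by (intro Bochner_Integration.integral_cong) auto

lemma lehmer_mean_cong:
  assumes "\<And>u. u \<in> sphere 0 1 \<Longrightarrow> F u = G u"
  shows "lehmer_mean q F = lehmer_mean q G"
  unfolding lehmer_mean_def using assms by (intro arg_cong2[of _ _ _ _ "(/)"] integral_cone_cong) auto

lemma lehmer_mean_cmult:
  assumes pos: "\<And>u. u \<in> sphere 0 1 \<Longrightarrow> 0 < F u" and c: "0 < c"
  shows "lehmer_mean q (\<lambda>u. c * F u) = c * lehmer_mean q F"
proof -
  have "(\<integral>u. (c * F u) powr s \<partial>cone_measure) = c powr s * (\<integral>u. F u powr s \<partial>cone_measure)" for s
    unfolding integral_mult_right_zero[symmetric]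
    using pos c by (intro integral_cone_cong) (simp add: powr_mult less_imp_le)
  moreover have "c powr q = c * c powr (q - 1)" using c by (simp add: powr_mult_base)
  ultimately show ?thesis using c by (simp add: lehmer_mean_def)
qed

lemma lehmer_mean_const:
  assumes c: "0 < c"
  shows "lehmer_mean q (\<lambda>u::'a::euclidean_space. c) = c"
proof -
  have "0 < (\<integral>u. (1::real) \<partial>(cone_measure :: 'a measure))" by (rule cone_measure_integral_pos) auto
  moreover have "c powr q = c * c powr (q - 1)" using c by (simp add: powr_mult_base)
  ultimately show ?thesis using c by (simp add: lehmer_mean_def)
qed

lemma
  fixes F :: "'a::euclidean_space \<Rightarrow> real"
  assumes F: "continuous_on (sphere 0 1) F" and pos: "\<And>u. u \<in> sphere 0 1 \<Longrightarrow> 0 < F u"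
    and q: "1 \<le> q" and t: "0 < t"
  shows lehmer_mean_add_const_le: "lehmer_mean q (\<lambda>u. F u + t) \<le> lehmer_mean q F + t"
    and lehmer_mean_add_const_eqD: "1 < q \<Longrightarrow> lehmer_mean q (\<lambda>u. F u + t) = lehmer_mean q F + t \<Longrightarrow>
      u \<in> sphere 0 1 \<Longrightarrow> F u = lehmer_mean q F"
proof -
  \<comment> \<open>\<open>?D\<close> is \<open>F powr (q - 1) * (F - ?m) * (\<phi> ?m - \<phi> F)\<close> with the decreasing function
    \<open>\<phi> a = ((a + t) / a) powr (q - 1)\<close>, hence nonnegative; comparing with \<open>?m\<close> avoids a
    double integral.\<close>
  let ?m = "lehmer_mean q F"
  let ?k = "((?m + t) / ?m) powr (q - 1)"
  let ?D = "\<lambda>u. (F u - ?m) * (?k * F u powr (q - 1) - (F u + t) powr (q - 1))"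
  let ?W = "\<integral>u. (F u + t) powr (q - 1) \<partial>cone_measure"
  have cF: "continuous_on (sphere 0 1) (\<lambda>u. F u powr s)" for s
    by (intro continuous_on_powr_pos F pos)
  have cFt: "continuous_on (sphere 0 1) (\<lambda>u. (F u + t) powr s)" for s
    by (intro continuous_on_powr_pos continuous_intros F) (use pos t in force)
  have posF: "0 < (\<integral>u. F u powr s \<partial>cone_measure)" for s
    by (intro cone_measure_integral_pos cF) (use pos in force)
  have W: "0 < ?W"
    by (intro cone_measure_integral_pos cFt) (use pos t in force)
  have m: "0 < ?m" using posF by (simp add: lehmer_mean_def)
  have Fq: "F u powr q = F u * F u powr (q - 1)"
    and Ftq: "(F u + t) powr q = (F u + t) * (F u + t) powr (q - 1)" if "u \<in> sphere 0 1" for u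
    using pos[OF that] t by (simp_all add: powr_mult_base)
  have "(\<integral>u. ?D u \<partial>cone_measure) =
      (\<integral>u. (?k * F u powr q - ?m * ?k * F u powr (q - 1))
        - ((F u + t) powr q - (?m + t) * (F u + t) powr (q - 1)) \<partial>cone_measure)"
    by (intro integral_cone_cong) (simp only: Fq Ftq, simp add: algebra_simps)
  also have "\<dots> = (?k * (\<integral>u. F u powr q \<partial>cone_measure)
        - ?m * ?k * (\<integral>u. F u powr (q - 1) \<partial>cone_measure))
      - ((\<integral>u. (F u + t) powr q \<partial>cone_measure) - (?m + t) * ?W)"
    using integrable_cone_measure[OF cF] integrable_cone_measure[OF cFt]
    by (simp add: Bochner_Integration.integral_diff)
  \<comment> \<open>This bracket cancels because \<open>?m\<close> is the quotient of the two
    integrals; comparison with exactly this value makes \<open>?k\<close> disappear.\<close>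
  also have "?k * (\<integral>u. F u powr q \<partial>cone_measure)
      - ?m * ?k * (\<integral>u. F u powr (q - 1) \<partial>cone_measure) = 0"
    using posF[of "q - 1"] by (simp add: lehmer_mean_def)
  also have "0 - ((\<integral>u. (F u + t) powr q \<partial>cone_measure) - (?m + t) * ?W)
      = (?m + t - lehmer_mean q (\<lambda>u. F u + t)) * ?W"
  proof -
    have "lehmer_mean q (\<lambda>u. F u + t) * ?W = (\<integral>u. (F u + t) powr q \<partial>cone_measure)"
      using W unfolding lehmer_mean_def by simp
    then show ?thesis by (simp only: left_diff_distrib)
  qed
  finally have intD: "(\<integral>u. ?D u \<partial>cone_measure) = (?m + t - lehmer_mean q (\<lambda>u. F u + t)) * ?W" .
  have eq: "?k * F u powr (q - 1) = ((?m + t) / ?m * F u) powr (q - 1)" if "u \<in> sphere 0 1" for u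
    using pos[OF that] m t by (subst powr_mult) auto
  \<comment> \<open>The bases compared in \<open>?D\<close> differ by a positive multiple of
    \<open>a - ?m\<close>. This decides the sign of the second factor of \<open>?D\<close>, and
    shows that the bases agree only at \<open>a = ?m\<close>, which settles equality.\<close>
  have diff: "(?m + t) / ?m * a - (a + t) = t / ?m * (a - ?m)" for a
    using m by (simp add: field_simps)
  have D0: "0 \<le> ?D u" if u: "u \<in> sphere 0 1" for u
  proof (cases "?m \<le> F u")
    case True
    then have "F u + t \<le> (?m + t) / ?m * F u" using diff[of "F u"] m t
      by (smt (verit) divide_nonneg_nonneg mult_nonneg_nonneg)
    then have "(F u + t) powr (q - 1) \<le> ?k * F u powr (q - 1)"
      unfolding eq[OF u] using q pos[OF u] t by (intro powr_mono2) auto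
    then show ?thesis using True by simp
  next
    case False
    then have "(?m + t) / ?m * F u \<le> F u + t" using diff[of "F u"] m t
      by (smt (verit) divide_nonneg_nonneg mult_nonneg_nonpos)
    then have "?k * F u powr (q - 1) \<le> (F u + t) powr (q - 1)"
      unfolding eq[OF u] using q pos[OF u] m t by (intro powr_mono2) auto
    then show ?thesis using False by (simp add: mult_nonpos_nonpos)
  qed
  have cD: "continuous_on (sphere 0 1) ?D" by (intro continuous_intros F cF cFt)
  have "0 \<le> (\<integral>u. ?D u \<partial>cone_measure)"
    by (intro integral_nonneg_AE) (auto intro!: AE_I2 D0 simp del: mult_le_0_iff zero_le_mult_iff)
  then show "lehmer_mean q (\<lambda>u. F u + t) \<le> ?m + t"
    unfolding intD using W by (simp add: zero_le_mult_iff)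
  show "F u = ?m" if q1: "1 < q" and e: "lehmer_mean q (\<lambda>u. F u + t) = ?m + t"
    and u: "u \<in> sphere 0 1"
  proof (rule ccontr)
    assume ne: "F u \<noteq> ?m"
    \<comment> \<open>Equality makes the integral of the continuous nonnegative \<open>?D\<close>
      vanish, hence \<open>?D\<close> itself in every direction. As \<open>q > 1\<close>, the
      exponent \<open>q - 1\<close> can then be inverted.\<close>
    have "?D u = 0"
      by (rule cone_measure_integral_eq_0[OF cD D0 _ u]) (auto simp: intD e)
    then have "((?m + t) / ?m * F u) powr (q - 1) = (F u + t) powr (q - 1)"
      using ne by (simp add: eq[OF u])
    then have "(((?m + t) / ?m * F u) powr (q - 1)) powr (1 / (q - 1))
        = ((F u + t) powr (q - 1)) powr (1 / (q - 1))" by simp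
    then have "(?m + t) / ?m * F u = F u + t" using q1 m t pos[OF u] by (simp add: powr_powr)
    then show False using diff[of "F u"] ne m t by simp
  qed
qed

section \<open>Dual surface area\<close>

text \<open>Instead of verifying the star body axioms for the image, a star body with the expected
  radial function is taken and the image is identified with it by testing membership along
  rays.\<close>

lemma
  fixes K :: "'a::euclidean_space set"
  assumes K: "star_body K" and c: "0 < c"
  shows star_body_radial_scale: "star_body (radial_scale p c K)"
    and radial_radial_scale: "u \<in> sphere 0 1 \<Longrightarrow> radial (radial_scale p c K) u = c powr (1 / p) * radial K u"
proof -
  let ?a = "c powr (1 / p)"
  have a: "0 < ?a" using c by simp
  obtain M where M: "star_body M" "\<And>u. u \<in> sphere 0 1 \<Longrightarrow> radial M u = ?a * radial K u"
    using ex_star_body_radial[of "\<lambda>u. ?a * radial K u"] star_body_pos[OF K] star_body_cont[OF K] a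
    by (metis continuous_on_mult_left mult_pos_pos)
  have "radial_scale p c K = M"
  proof (rule set_eqI)
    fix x
    have "x \<in> radial_scale p c K \<longleftrightarrow> x /\<^sub>R ?a \<in> K"
    proof
      assume "x /\<^sub>R ?a \<in> K"
      then have "?a *\<^sub>R (x /\<^sub>R ?a) \<in> radial_scale p c K" unfolding radial_scale_def by (rule imageI)
      then show "x \<in> radial_scale p c K" using a by simp
    qed (use a c in \<open>auto simp: radial_scale_def\<close>)
    also have "\<dots> \<longleftrightarrow> x \<in> M"
    proof (cases "x = 0")
      case True
      then show ?thesis using star_body_zero_mem[OF K] star_body_zero_mem[OF M(1)] by simp
    next
      case False
      then have "x /\<^sub>R ?a \<in> K \<longleftrightarrow> norm x / ?a \<le> radial K (sgn x)"
        using star_body_mem_sgn[OF K, of "x /\<^sub>R ?a"] a by (simp add: sgn_scaleR divide_inverse mult.commute)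
      also have "\<dots> \<longleftrightarrow> norm x \<le> ?a * radial K (sgn x)"
        using a by (simp add: pos_divide_le_eq mult.commute)
      also have "\<dots> \<longleftrightarrow> x \<in> M"
        using star_body_mem_sgn[OF M(1) False] M(2)[of "sgn x"] False by (simp add: norm_sgn)
      finally show ?thesis .
    qed
    finally show "x \<in> radial_scale p c K \<longleftrightarrow> x \<in> M" .
  qed
  then show "star_body (radial_scale p c K)"
    "u \<in> sphere 0 1 \<Longrightarrow> radial (radial_scale p c K) u = ?a * radial K u" using M by auto
qed

lemma star_body_cball:
  assumes "0 < r"
  shows "star_body (cball 0 r :: 'a::euclidean_space set)"
    and "u \<in> sphere 0 1 \<Longrightarrow> radial (cball 0 r :: 'a::euclidean_space set) u = r"
proof -
  have rad: "radial (cball 0 r :: 'a set) u = r" if "u \<in> sphere 0 1" for u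
  proof -
    have "{t. 0 \<le> t \<and> t *\<^sub>R u \<in> cball 0 r} = {0..r}" using that by auto
    then show ?thesis using assms by (simp add: radial_def)
  qed
  then show "u \<in> sphere 0 1 \<Longrightarrow> radial (cball 0 r) u = r" .
  have "continuous_on (sphere 0 1) (radial (cball 0 r :: 'a set))"
    using rad by (subst continuous_on_cong[OF refl, of _ _ "\<lambda>_. r"]) auto
  moreover have "closed_segment 0 x \<subseteq> cball 0 r" if "x \<in> cball 0 r" for x :: 'a
    using that assms by (intro closed_segment_subset) auto
  moreover have "cball (0::'a) r \<noteq> {}" using assms by auto
  ultimately show "star_body (cball 0 r :: 'a set)"
    using rad assms by (simp add: star_body_def del: cball_eq_empty)
qed

lemma
  fixes K E :: "'a::euclidean_space set"
  assumes "p \<noteq> 0" "star_body K" "star_body E"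
  shows star_body_radial_sum: "star_body (radial_sum p K E)"
    and radial_radial_sum: "u \<in> sphere 0 1 \<Longrightarrow>
      radial (radial_sum p K E) u powr p = radial K u powr p + radial E u powr p"
  using theI'[OF ex1_radial_sum[OF assms]] unfolding radial_sum_def by blast+

lemma star_body_volume_powr:
  fixes K :: "'a::euclidean_space set"
  assumes K: "star_body K" and p: "p \<noteq> 0"
  shows "measure lebesgue K = (\<integral>u. (radial K u powr p) powr (real DIM('a) / p) \<partial>cone_measure)"
  unfolding star_body_volume[OF K]
  using star_body_pos[OF K] p by (intro integral_cone_cong) (simp add: powr_powr powr_realpow)

text \<open>Mean value theorem, with the derivative at the intermediate point bounded by its values
  at the ends since \<open>q >= 1\<close>.\<close>

lemma powr_increment_bounds:
  fixes a q e :: real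
  assumes "0 < a" "0 < e" "1 \<le> q"
  shows "q * a powr (q - 1) * e \<le> (a + e) powr q - a powr q"
    and "(a + e) powr q - a powr q \<le> q * (a + e) powr (q - 1) * e"
proof -
  have "\<exists>z. a < z \<and> z < a + e \<and> (a + e) powr q - a powr q = (a + e - a) * (q * z powr (q - 1))"
    using assms by (intro MVT2 has_real_derivative_powr) auto
  then obtain z where z: "a < z" "z < a + e" "(a + e) powr q - a powr q = e * (q * z powr (q - 1))"
    by auto
  have "a powr (q - 1) \<le> z powr (q - 1)" "z powr (q - 1) \<le> (a + e) powr (q - 1)"
    using z assms by (auto intro!: powr_mono2)
  then show "q * a powr (q - 1) * e \<le> (a + e) powr q - a powr q"
    "(a + e) powr q - a powr q \<le> q * (a + e) powr (q - 1) * e"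
    unfolding z(3) using assms by (auto simp: mult.commute mult.left_commute intro!: mult_left_mono)
qed

text \<open>Adding the scaled ball replaces \<open>F\<close> by \<open>F + e\<close>.
  Differentiation under the integral is done by squeezing: the difference quotient lies between
  \<open>q * ?J\<close> and \<open>q * (1 + e / m) powr (q - 1) * ?J\<close>. The factor
  \<open>n / p\<close> in place of the usual \<open>1 / p\<close> compensates for the normalisation
  of \<open>cone_measure\<close>.\<close>

lemma dual_surface_area_eq:
  fixes K :: "'a::euclidean_space set"
  assumes K: "star_body K" and p: "0 < p" "p \<le> real DIM('a)"
  shows "dual_surface_area p K =
    real DIM('a) / p * (\<integral>u. (radial K u powr p) powr (real DIM('a) / p - 1) \<partial>cone_measure)"
proof -
  define q where "q = real DIM('a) / p"
  define F where "F = (\<lambda>u. radial K u powr p)"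
  let ?V = "\<lambda>e. measure lebesgue (radial_sum p K (radial_scale p e (cball 0 1)))"
  let ?J = "\<integral>u. F u powr (q - 1) \<partial>cone_measure"
  have q: "1 \<le> q" using p by (simp add: q_def)
  have Fpos: "0 < F u" if "u \<in> sphere 0 1" for u using star_body_pos[OF K that] by (simp add: F_def)
  have Fc: "continuous_on (sphere 0 1) F"
    unfolding F_def by (intro continuous_on_powr_pos star_body_cont star_body_pos K)
  have int: "integrable cone_measure (\<lambda>u. (F u + e) powr s)" if "0 \<le> e" for e s
    using that Fpos
    by (intro integrable_cone_measure continuous_on_powr_pos continuous_intros Fc)
       (auto simp: add_pos_nonneg)
  have int0: "integrable cone_measure (\<lambda>u. F u powr s)" for s
    using int[of 0] by simp
  have Ve: "?V e = (\<integral>u. (F u + e) powr q \<partial>cone_measure)" if e: "0 < e" for e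
  proof -
    let ?B = "radial_scale p e (cball 0 1) :: 'a set"
    have B: "star_body ?B" using e by (intro star_body_radial_scale star_body_cball) auto
    have rB: "radial ?B u powr p = e" if "u \<in> sphere 0 1" for u
      using p e that by (simp add: radial_radial_scale star_body_cball powr_powr)
    have S: "star_body (radial_sum p K ?B)" using p by (intro star_body_radial_sum K B) auto
    have "radial (radial_sum p K ?B) u powr p = F u + e" if "u \<in> sphere 0 1" for u
      using p that by (simp add: radial_radial_sum[OF _ K B] rB F_def)
    then show ?thesis
      using p by (simp only: star_body_volume_powr[OF S, of p] q_def) (intro integral_cone_cong, simp)
  qed
  \<comment> \<open>At \<open>e = 0\<close> the scaled ball is \<open>{0}\<close>, since
    \<open>0 powr (1 / p) = 0\<close>. This is not a star body, so the base value of the difference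
    quotient needs its own argument.\<close>
  have V0: "?V 0 = (\<integral>u. F u powr q \<partial>cone_measure)"
  proof -
    have "radial_scale p 0 (cball 0 1) = {0::'a}" by (auto simp: radial_scale_def image_constant_conv)
    then show ?thesis using p star_body_volume_powr[OF K, of p]
      by (simp add: radial_sum_zero[OF _ K] q_def F_def)
  qed
  \<comment> \<open>The minimum of \<open>F\<close> on the compact sphere turns the additive
    perturbation into a multiplicative one, \<open>F u + e <= (1 + e / m) * F u\<close>, uniformly
    in \<open>u\<close>; the factor then leaves the integral.\<close>
  obtain m where m: "0 < m" "\<And>u. u \<in> sphere 0 1 \<Longrightarrow> m \<le> F u"
  proof -
    obtain b :: 'a where b: "b \<in> sphere 0 1" using norm_Basis nonempty_Basis by fastforce
    then obtain v where "v \<in> sphere 0 1" "\<And>u. u \<in> sphere 0 1 \<Longrightarrow> F v \<le> F u"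
      using continuous_attains_inf[OF compact_sphere _ Fc] by blast
    then show ?thesis using that[of "F v"] Fpos by auto
  qed
  have quot: "q * ?J \<le> (?V e - ?V 0) / (e - 0)"
      "(?V e - ?V 0) / (e - 0) \<le> q * (1 + e / m) powr (q - 1) * ?J" if e: "0 < e" for e
  proof -
    have D: "?V e - ?V 0 = (\<integral>u. (F u + e) powr q - F u powr q \<partial>cone_measure)"
      unfolding Ve[OF e] V0 using int[of e] int0 e by (simp add: Bochner_Integration.integral_diff)
    have "(\<integral>u. q * e * F u powr (q - 1) \<partial>cone_measure) \<le> ?V e - ?V 0"
      unfolding D
    proof (rule integral_mono)
      fix u :: 'a assume "u \<in> space cone_measure"
      then show "q * e * F u powr (q - 1) \<le> (F u + e) powr q - F u powr q"
        using powr_increment_bounds(1)[OF Fpos e q] by (simp add: mult_ac)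
    qed (use int[of e] int0 e in auto)
    then show "q * ?J \<le> (?V e - ?V 0) / (e - 0)" using e by (simp add: field_simps)
    have "?V e - ?V 0 \<le> (\<integral>u. q * e * (1 + e / m) powr (q - 1) * F u powr (q - 1) \<partial>cone_measure)"
      unfolding D
    proof (rule integral_mono)
      fix u :: 'a assume "u \<in> space cone_measure"
      then have u: "u \<in> sphere 0 1" by simp
      have "e * m \<le> e * F u" using m(2)[OF u] e by simp
      then have "F u + e \<le> (1 + e / m) * F u" using m(1) by (simp add: field_simps)
      then have "(F u + e) powr (q - 1) \<le> ((1 + e / m) * F u) powr (q - 1)"
        using Fpos[OF u] e q by (intro powr_mono2) auto
      also have "\<dots> = (1 + e / m) powr (q - 1) * F u powr (q - 1)"
        using Fpos[OF u] e m(1) by (simp add: powr_mult)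
      finally have "q * e * (F u + e) powr (q - 1)
          \<le> q * e * ((1 + e / m) powr (q - 1) * F u powr (q - 1))"
        using q e by (intro mult_left_mono) auto
      then show "(F u + e) powr q - F u powr q
          \<le> q * e * (1 + e / m) powr (q - 1) * F u powr (q - 1)"
        using powr_increment_bounds(2)[OF Fpos[OF u] e q] by (simp add: mult_ac)
    qed (use int[of e] int0 e in auto)
    then show "(?V e - ?V 0) / (e - 0) \<le> q * (1 + e / m) powr (q - 1) * ?J"
      using e by (simp add: field_simps)
  qed
  have "((\<lambda>e. q * (1 + e / m) powr (q - 1) * ?J) \<longlongrightarrow> q * (1 + 0 / m) powr (q - 1) * ?J) (at_right 0)"
    using m(1) by (intro tendsto_intros) auto
  then have up: "((\<lambda>e. q * (1 + e / m) powr (q - 1) * ?J) \<longlongrightarrow> q * ?J) (at_right 0)" by simp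
  have "((\<lambda>e. (?V e - ?V 0) / (e - 0)) \<longlongrightarrow> q * ?J) (at_right 0)"
    by (rule tendsto_sandwich[OF eventually_at_rightI[of 0 1] eventually_at_rightI[of 0 1] tendsto_const up])
       (use quot in auto)
  then have "(?V has_vector_derivative q * ?J) (at_right 0)"
    by (simp only: has_real_derivative_iff_has_vector_derivative[symmetric] has_field_derivative_iff)
  then show ?thesis
    unfolding dual_surface_area_def q_def F_def
    by (intro vector_derivative_within) (simp add: trivial_limit_at_right_real)
qed

section \<open>The ratio as a Lehmer mean, and the inequality for radial combinations\<close>

lemma volume_div_dual_surface_area:
  fixes K :: "'a::euclidean_space set"
  assumes K: "star_body K" and p: "0 < p" "p \<le> real DIM('a)"
  shows "measure lebesgue K / dual_surface_area p K =
    p / real DIM('a) * lehmer_mean (real DIM('a) / p) (\<lambda>u. radial K u powr p)"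
  using p by (simp add: star_body_volume_powr[OF K, of p] dual_surface_area_eq[OF assms] lehmer_mean_def)

lemma radial_combination_powr:
  fixes K E :: "'a::euclidean_space set"
  assumes K: "star_body K" and E: "star_body E" and p: "p \<noteq> 0" and ab: "0 < a" "0 < b"
    and u: "u \<in> sphere 0 1"
  shows "radial (radial_sum p (radial_scale p a K) (radial_scale p b E)) u powr p
    = a * radial K u powr p + b * radial E u powr p"
  using star_body_pos[OF K u] star_body_pos[OF E u] ab p
  by (simp add: radial_radial_sum[OF p star_body_radial_scale[OF K] star_body_radial_scale[OF E] u]
      radial_radial_scale[OF K _ u] radial_radial_scale[OF E _ u] powr_mult powr_powr)

theorem theorem5p4:
  fixes K :: "(real ^ 'n) set" and p r :: real
  assumes "star_body K" and "0 < p" and "p \<le> real CARD('n)" and "0 < r"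
  shows
    "(\<forall>l\<in>{0<..<1}.
        measure lebesgue (radial_sum p (radial_scale p (1 - l) K) (radial_scale p l (cball 0 r)))
          / dual_surface_area p (radial_sum p (radial_scale p (1 - l) K) (radial_scale p l (cball 0 r)))
        \<le> (1 - l) * (measure lebesgue K / dual_surface_area p K)
          + l * (measure lebesgue (cball 0 r :: (real ^ 'n) set)
                 / dual_surface_area p (cball 0 r :: (real ^ 'n) set)))
     \<and> (p \<noteq> real CARD('n) \<longrightarrow>
         ((\<exists>l\<in>{0<..<1}.
            measure lebesgue (radial_sum p (radial_scale p (1 - l) K) (radial_scale p l (cball 0 r)))
              / dual_surface_area p (radial_sum p (radial_scale p (1 - l) K) (radial_scale p l (cball 0 r)))
            = (1 - l) * (measure lebesgue K / dual_surface_area p K)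
              + l * (measure lebesgue (cball 0 r :: (real ^ 'n) set)
                     / dual_surface_area p (cball 0 r :: (real ^ 'n) set)))
          \<longleftrightarrow> (\<exists>s>0. K = cball 0 s)))"
proof -
  note K = assms(1) and p = assms(2) and r = assms(4)
  define q where "q = real CARD('n) / p"
  define F where "F = (\<lambda>u. radial K u powr p)"
  let ?B = "cball 0 r :: (real ^ 'n) set"
  let ?M = "\<lambda>l. radial_sum p (radial_scale p (1 - l) K) (radial_scale p l ?B)"
  let ?R = "\<lambda>L. measure lebesgue L / dual_surface_area p (L :: (real ^ 'n) set)"
  let ?t = "\<lambda>l. l * r powr p"
  have B: "star_body ?B" using r by (rule star_body_cball(1))
  have q: "1 \<le> q" using p assms(3) by (simp add: q_def)
  have Fpos: "0 < F u" if "u \<in> sphere 0 1" for u using star_body_pos[OF K that] by (simp add: F_def)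
  have Fc: "continuous_on (sphere 0 1) F"
    unfolding F_def by (intro continuous_on_powr_pos star_body_cont star_body_pos K)
  have R: "?R L = lehmer_mean q (\<lambda>u. radial L u powr p) / q" if "star_body L" for L
    using volume_div_dual_surface_area[OF that p] assms(3) by (simp add: q_def)
  have RK: "?R K = lehmer_mean q F / q" unfolding F_def by (rule R[OF K])
  have RB: "?R (cball 0 s) = s powr p / q" if "0 < s" for s
  proof -
    have "lehmer_mean q (\<lambda>u. radial (cball 0 s :: (real ^ 'n) set) u powr p)
        = lehmer_mean q (\<lambda>u::real ^ 'n. s powr p)"
      using that by (intro lehmer_mean_cong) (simp add: star_body_cball(2))
    then show ?thesis
      using that unfolding R[OF star_body_cball(1)[OF that]] by (simp add: lehmer_mean_const)
  qed
  have RM: "?R (?M l) = lehmer_mean q (\<lambda>u. (1 - l) * F u + ?t l) / q" if l: "l \<in> {0<..<1}" for l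
  proof -
    have S: "star_body (?M l)"
      using p l by (intro star_body_radial_sum star_body_radial_scale K B) auto
    have "radial (?M l) u powr p = (1 - l) * F u + ?t l" if "u \<in> sphere 0 1" for u
      using p l r that by (simp add: radial_combination_powr[OF K B] star_body_cball(2) F_def)
    then have "lehmer_mean q (\<lambda>u. radial (?M l) u powr p) = lehmer_mean q (\<lambda>u. (1 - l) * F u + ?t l)"
      by (rule lehmer_mean_cong)
    then show ?thesis unfolding R[OF S] by simp
  qed
  have scale: "lehmer_mean q (\<lambda>u. (1 - l) * F u) = (1 - l) * lehmer_mean q F" if "l \<in> {0<..<1}" for l
    using that by (intro lehmer_mean_cmult Fpos) auto
  have aux: "continuous_on (sphere 0 1) (\<lambda>u. (1 - l) * F u)"
      "\<And>u. u \<in> sphere 0 1 \<Longrightarrow> 0 < (1 - l) * F u" "0 < ?t l" if "l \<in> {0<..<1}" for l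
    using that Fpos r by (auto intro!: continuous_intros Fc)
  have rhs: "(1 - l) * ?R K + l * ?R ?B = ((1 - l) * lehmer_mean q F + ?t l) / q" for l
    unfolding RK RB[OF r] by (simp add: add_divide_distrib)
  have "?R (?M l) \<le> (1 - l) * ?R K + l * ?R ?B" if l: "l \<in> {0<..<1}" for l
    using lehmer_mean_add_const_le[OF aux(1,2)[OF l] q aux(3)[OF l]] q
    unfolding RM[OF l] rhs scale[OF l] by (simp add: divide_right_mono)
  moreover have "\<exists>s>0. K = cball 0 s"
    if ne: "p \<noteq> real CARD('n)" and l: "l \<in> {0<..<1}"
      and eq: "?R (?M l) = (1 - l) * ?R K + l * ?R ?B" for l
  proof -
    have q1: "1 < q" using p assms(3) ne by (simp add: q_def)
    have "lehmer_mean q (\<lambda>u. (1 - l) * F u + ?t l) = lehmer_mean q (\<lambda>u. (1 - l) * F u) + ?t l"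
      using eq q unfolding RM[OF l] rhs scale[OF l] by simp
    \<comment> \<open>The equality case is applied to \<open>(1 - l) * F\<close>; by homogeneity the
      factor \<open>1 - l\<close>, nonzero as \<open>l < 1\<close>, cancels.\<close>
    from lehmer_mean_add_const_eqD[OF aux(1,2)[OF l] q aux(3)[OF l] q1 this]
    have F: "F u = lehmer_mean q F" if "u \<in> sphere 0 1" for u
      using that l unfolding scale[OF l] by simp
    \<comment> \<open>The constant value of \<open>F\<close> is the \<open>p\<close>-th power of the
      radius, so the radius is recovered by the inverse power.\<close>
    define s where "s = lehmer_mean q F powr (1 / p)"
    have rad: "radial K u = s" if "u \<in> sphere 0 1" for u
    proof -
      have "radial K u = F u powr (1 / p)"
        using star_body_pos[OF K that] p by (simp add: F_def powr_powr)
      then show ?thesis unfolding s_def F[OF that] .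
    qed
    obtain b :: "real ^ 'n" where "b \<in> sphere 0 1" using norm_Basis nonempty_Basis by fastforce
    then have s: "0 < s" using rad star_body_pos[OF K] by metis
    have "K = cball 0 s"
      by (intro star_body_eqI K star_body_cball(1) s) (simp add: rad star_body_cball(2) s)
    then show ?thesis using s by blast
  qed
  moreover have "\<exists>l\<in>{0<..<1}. ?R (?M l) = (1 - l) * ?R K + l * ?R ?B" if "\<exists>s>0. K = cball 0 s"
  proof -
    obtain s where s: "0 < s" "K = cball 0 s" using \<open>\<exists>s>0. K = cball 0 s\<close> by blast
    let ?c = "(1 - 1/2) * s powr p + 1/2 * r powr p"
    \<comment> \<open>For a centred ball every weight gives equality, as \<open>F\<close> and its
      translates are constant; the midpoint serves as witness.\<close>
    have half: "1/2 \<in> {0<..<1::real}" by simp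
    have "lehmer_mean q (\<lambda>u. (1 - 1/2) * F u + ?t (1/2)) = lehmer_mean q (\<lambda>u::real ^ 'n. ?c)"
      using s by (intro lehmer_mean_cong) (simp add: F_def star_body_cball(2))
    also have "\<dots> = ?c" using s r by (intro lehmer_mean_const add_pos_pos) auto
    finally have "?R (?M (1/2)) = ?c / q" unfolding RM[OF half] by simp
    also have "\<dots> = (1 - 1/2) * ?R K + 1/2 * ?R ?B"
      unfolding s(2) RB[OF s(1)] RB[OF r] by (simp add: add_divide_distrib)
    finally show ?thesis using half by blast
  qed
  ultimately show ?thesis by blast
qed

end
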